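(* The hydrostatic reconstruction scheme for the shallow water equations with the numerical flux $$\mathbf f^{ES}_\epsilon=\mathbf f^{EC}_\epsilon-\tfrac12|\lambda_{\max}|[\![\mathbf u_\epsilon]\!],\qquad \mathbf f^{EC}_\epsilon=\begin{pmatrix}\{\!\{h_\epsilon v\}\!\}\\ \{\!\{h_\epsilon v\}\!\}\{\!\{v\}\!\}\end{pmatrix},$$ and the numerical nonconservative term $\tfrac12\boldsymbol\phi_\epsilon^-\circ[\![\mathbf r_\epsilon]\!]$ is entropy stable; that is, at every interface and for all states, $$[\![\mathbf w]\!]^T\mathbf f^{ES}_\epsilon-\{\!\{\mathbf w\circ\boldsymbol\phi_\epsilon\}\!\}^T[\![\mathbf r_\epsilon]\!]\le0 .$$
   Context: Shallow water equations (gravity $g>0$, bottom $b(x)$): $\partial_t h+\partial_x(hv)=0$, $\partial_t(hv)+\partial_x(hv^2)=-gh\,\partial_x(h+b)$. Write $\mathbf u=(h,hv)^T$, $\mathbf f=(hv,hv^2)^T$, $\boldsymbol\phi=g(0,h)^T$, $\mathbf r=(0,h+b)^T$; $\circ$ is the Hadamard product. Entropy $S=\frac12hv^2+\frac12gh^2+ghb$, entropy variables $\mathbf w=\partial_{\mathbf u}S=\big(g(h+b)-\frac12v^2,\,v\big)^T$, entropy flux $f^S=\mathbf w^T\mathbf f$. Data: cells of size $\Delta x$ with constant values $b\in\mathbb R$, $h\ge0$, $v\in\mathbb R$. At an interface, $-$ and $+$ denote left and right cell values, $\{\!\{a\}\!\}=\frac12(a^++a^-)$, $[\![a]\!]=a^+-a^-$,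 $H^\pm=h^\pm+b^\pm$. Hydrostatic reconstruction at each interface: $b_\epsilon^\pm=\min(H^\pm,\max(b^-,b^+))$, $H_\epsilon^\pm=\max(H^\pm,b_\epsilon^\pm)$, $h_\epsilon^\pm=H_\epsilon^\pm-b_\epsilon^\pm$, $\mathbf u_\epsilon^\pm=(h_\epsilon^\pm,h_\epsilon^\pm v^\pm)^T$; $\boldsymbol\phi_\epsilon^\pm,\mathbf r_\epsilon^\pm$ are evaluated with $h_\epsilon^\pm,b_\epsilon^\pm$, while $\mathbf w^\pm$ is evaluated with the unreconstructed cell values. $\lambda_{\max}=\max(|v^+|,|v^-|)+\max(\sqrt{gh^+},\sqrt{gh^-})$. Hydrostatic reconstruction scheme with numerical flux $\mathbf f^*_\epsilon$: $\Delta x\frac{d}{dt}\mathbf u_i=-(\mathbf f^*_{\epsilon,i+1/2}-\mathbf f^*_{\epsilon,i-1/2})-\tfrac12\boldsymbol\phi^-_{\epsilon,i+1/2}\circ[\![\mathbf r_\epsilon]\!]_{i+1/2}-\tfrac12\boldsymbol\phi^+_{\epsilon,i-1/2}\circ[\![\mathbf r_\epsilon]\!]_{i-1/2}$. The contribution of a single interface to the two adjacent cells changes their total entropy by $\Delta x\frac{d}{dt}(S^-+S^+)=[\![\mathbf w]\!]^T\mathbf f^*_\epsilon-[\![f^S]\!]-\{\!\{\mathbf w\circ\boldsymbol\phi_\epsilon\}\!\}^T[\![\mathbf r_\epsilon]\!]$; the scheme is entropy stable if this is $\le-[\![f^S]\!]$ at each interface, i.e. if $[\![\mathbf w]\!]^T\mathbf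 f^*_\epsilon-\{\!\{\mathbf w\circ\boldsymbol\phi_\epsilon\}\!\}^T[\![\mathbf r_\epsilon]\!]\le0$. *)

theory Defs
  imports "HOL-Analysis.Analysis"
begin

text \<open>
  The velocity is stored separately because it is part of the data also in dry cells,
  where it cannot be recovered from the conserved variables.
\<close>

record cell =
  bottom :: real
  depth :: real
  vel :: real

definition admissible :: "cell \<Rightarrow> bool" where
  "admissible c \<longleftrightarrow> 0 \<le> depth c"

definition level :: "cell \<Rightarrow> real" where
  "level c = depth c + bottom c"

definition conserved :: "cell \<Rightarrow> real^2" where
  "conserved c = vector [depth c, depth c * vel c]"

definition phys_flux :: "cell \<Rightarrow> real^2" where
  "phys_flux c = vector [depth c * vel c, depth c * (vel c)\<^sup>2]"

definition nc_coeff :: "real \<Rightarrow> cell \<Rightarrow> real^2" where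
  "nc_coeff g c = g *\<^sub>R vector [0, depth c]"

definition nc_var :: "cell \<Rightarrow> real^2" where
  "nc_var c = vector [0, depth c + bottom c]"

definition entropy :: "real \<Rightarrow> cell \<Rightarrow> real" where
  "entropy g c =
     1/2 * depth c * (vel c)\<^sup>2 + 1/2 * g * (depth c)\<^sup>2 + g * depth c * bottom c"

text \<open>
  This is the gradient of the entropy in the conserved variables, as shown in
  \<open>entropy_has_derivative\<close> below for wet cells; the closed form is also used in dry cells.
\<close>

definition entropy_var :: "real \<Rightarrow> cell \<Rightarrow> real^2" where
  "entropy_var g c = vector [g * (depth c + bottom c) - 1/2 * (vel c)\<^sup>2, vel c]"

definition entropy_flux :: "real \<Rightarrow> cell \<Rightarrow> real" where
  "entropy_flux g c = entropy_var g c \<bullet> phys_flux c"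

definition cell_of_conserved :: "real \<Rightarrow> real^2 \<Rightarrow> cell" where
  "cell_of_conserved b u = \<lparr>bottom = b, depth = u $ 1, vel = u $ 2 / u $ 1\<rparr>"

lemma cell_of_conserved_conserved:
  "0 < depth c \<Longrightarrow> cell_of_conserved (bottom c) (conserved c) = c"
  by (simp add: cell_of_conserved_def conserved_def)

lemma entropy_has_derivative:
  assumes "0 < depth c"
  shows "((\<lambda>u. entropy g (cell_of_conserved (bottom c) u)) has_derivative
           (\<lambda>d. entropy_var g c \<bullet> d)) (at (conserved c))"
proof -
  have c: "conserved c $ 1 = depth c" "conserved c $ 2 = depth c * vel c"
    by (simp_all add: conserved_def)
  have nz: "conserved c $ 1 \<noteq> 0"
    using assms c by simp
  show ?thesis
    unfolding entropy_def cell_of_conserved_def cell.simps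
    apply (rule derivative_eq_intros refl nz | rule bounded_linear.has_derivative [OF bounded_linear_vec_nth])+
    using assms
    apply (auto simp: fun_eq_iff entropy_var_def inner_vec_def sum_2 c field_simps power2_eq_square)
    done
qed

text \<open>Below, \<open>L\<close> and \<open>R\<close> are the cells to the left (\<open>-\<close>) and right (\<open>+\<close>) of an interface.\<close>

definition jump :: "'a::real_vector \<Rightarrow> 'a \<Rightarrow> 'a" where
  "jump am ap = ap - am"

definition avg :: "'a::real_vector \<Rightarrow> 'a \<Rightarrow> 'a" where
  "avg am ap = (1/2) *\<^sub>R (ap + am)"

definition rec_bottom :: "cell \<Rightarrow> cell \<Rightarrow> cell \<Rightarrow> real" where
  "rec_bottom L R c = min (level c) (max (bottom L) (bottom R))"

definition rec_level :: "cell \<Rightarrow> cell \<Rightarrow> cell \<Rightarrow> real" where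
  "rec_level L R c = max (level c) (rec_bottom L R c)"

text \<open>The reconstructed state, at the interface between \<open>L\<close> and \<open>R\<close>, of \<open>c\<close>, one of these two cells.\<close>

definition rec_cell :: "cell \<Rightarrow> cell \<Rightarrow> cell \<Rightarrow> cell" where
  "rec_cell L R c =
     \<lparr>bottom = rec_bottom L R c, depth = rec_level L R c - rec_bottom L R c, vel = vel c\<rparr>"

definition lambda_max :: "real \<Rightarrow> cell \<Rightarrow> cell \<Rightarrow> real" where
  "lambda_max g L R =
     max \<bar>vel R\<bar> \<bar>vel L\<bar> + max (sqrt (g * depth R)) (sqrt (g * depth L))"

definition flux_EC :: "cell \<Rightarrow> cell \<Rightarrow> real^2" where
  "flux_EC L R =
     (let hL = depth (rec_cell L R L); hR = depth (rec_cell L R R)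
      in vector [avg (hL * vel L) (hR * vel R),
                 avg (hL * vel L) (hR * vel R) * avg (vel L) (vel R)])"

definition flux_ES :: "real \<Rightarrow> cell \<Rightarrow> cell \<Rightarrow> real^2" where
  "flux_ES g L R =
     flux_EC L R - (1/2 * \<bar>lambda_max g L R\<bar>) *\<^sub>R
       jump (conserved (rec_cell L R L)) (conserved (rec_cell L R R))"

text \<open>Multiplication on \<^typ>\<open>real^2\<close> is componentwise, i.e. the Hadamard product.\<close>

definition nc_term :: "real \<Rightarrow> cell \<Rightarrow> cell \<Rightarrow> cell \<Rightarrow> real^2" where
  "nc_term g L R c =
     (1/2) *\<^sub>R (nc_coeff g (rec_cell L R c) *
       jump (nc_var (rec_cell L R L)) (nc_var (rec_cell L R R)))"

text \<open>
  The semi-discrete scheme with numerical flux \<open>F\<close>: this is \<open>\<Delta>x\<close> times the time derivative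
  of the conserved variables in cell \<open>i\<close>. The interface \<open>i+1/2\<close> lies between \<open>U i\<close> and \<open>U (i + 1)\<close>.
\<close>

definition hr_scheme :: "real \<Rightarrow> (cell \<Rightarrow> cell \<Rightarrow> real^2) \<Rightarrow> (int \<Rightarrow> cell) \<Rightarrow> int \<Rightarrow> real^2" where
  "hr_scheme g F U i =
     - (F (U i) (U (i + 1)) - F (U (i - 1)) (U i))
     - nc_term g (U i) (U (i + 1)) (U i)
     - nc_term g (U (i - 1)) (U i) (U i)"

text \<open>
  The contributions of a single interface to its left and right cell. The physical fluxes
  cancel when the contributions of the two interfaces of a cell are added.
\<close>

definition contrib_left :: "real \<Rightarrow> (cell \<Rightarrow> cell \<Rightarrow> real^2) \<Rightarrow> cell \<Rightarrow> cell \<Rightarrow> real^2" where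
  "contrib_left g F L R = - (F L R - phys_flux L) - nc_term g L R L"

definition contrib_right :: "real \<Rightarrow> (cell \<Rightarrow> cell \<Rightarrow> real^2) \<Rightarrow> cell \<Rightarrow> cell \<Rightarrow> real^2" where
  "contrib_right g F L R = - (phys_flux R - F L R) - nc_term g L R R"

lemma hr_scheme_eq_contribs:
  "hr_scheme g F U i =
     contrib_left g F (U i) (U (i + 1)) + contrib_right g F (U (i - 1)) (U i)"
  by (simp add: hr_scheme_def contrib_left_def contrib_right_def)

text \<open>
  By the chain rule, this is \<open>\<Delta>x\<close> times the rate of change of the total entropy of the two
  cells adjacent to an interface that is due to that interface.
\<close>

definition interface_entropy_rate ::
    "real \<Rightarrow> (cell \<Rightarrow> cell \<Rightarrow> real^2) \<Rightarrow> cell \<Rightarrow> cell \<Rightarrow> real" where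
  "interface_entropy_rate g F L R =
     entropy_var g L \<bullet> contrib_left g F L R + entropy_var g R \<bullet> contrib_right g F L R"

lemma interface_entropy_rate_eq:
  "interface_entropy_rate g F L R =
     jump (entropy_var g L) (entropy_var g R) \<bullet> F L R -
     jump (entropy_flux g L) (entropy_flux g R) -
     avg (entropy_var g L * nc_coeff g (rec_cell L R L))
         (entropy_var g R * nc_coeff g (rec_cell L R R)) \<bullet>
       jump (nc_var (rec_cell L R L)) (nc_var (rec_cell L R R))"
  by (simp add: interface_entropy_rate_def contrib_left_def
      contrib_right_def nc_term_def entropy_flux_def jump_def avg_def inner_vec_def sum_2
      field_simps)

definition entropy_stable :: "real \<Rightarrow> (cell \<Rightarrow> cell \<Rightarrow> real^2) \<Rightarrow> bool" where
  "entropy_stable g F \<longleftrightarrow>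
     (\<forall>L R. admissible L \<longrightarrow> admissible R \<longrightarrow>
        interface_entropy_rate g F L R \<le> - jump (entropy_flux g L) (entropy_flux g R))"

end

theory Submission
  imports Defs
begin

text \<open>
  Write \<open>H = h + b\<close>. The reconstruction leaves the water level unchanged, \<open>H\<^sub>\<epsilon> = H\<close>, and the
  reconstructed depth is \<open>max 0 (H - max b\<^sup>- b\<^sup>+)\<close>, which is nonnegative and monotone in \<open>H\<close> with
  a threshold common to both sides of the interface.

  The flux \<open>flux_EC\<close> exactly balances the nonconservative term: in \<open>jump w \<bullet> flux_EC\<close> the kinetic
  terms cancel because \<open>jump (v\<^sup>2 / 2) = avg v * jump v\<close>, and what is left is
  \<open>g * jump H * avg (h\<^sub>\<epsilon> * v)\<close>. This is the nonconservative contribution, since only the second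
  components of \<open>avg (w * \<phi>\<^sub>\<epsilon>)\<close> and \<open>jump r\<^sub>\<epsilon>\<close> are nonzero and \<open>r\<^sub>\<epsilon>\<close> carries the level \<open>H\<close>.

  The dissipation contributes \<open>- \<bar>\<lambda>\<bar> / 2 * (jump w \<bullet> jump u\<^sub>\<epsilon>)\<close>. By the product rule
  \<open>jump (h\<^sub>\<epsilon> * v) = avg h\<^sub>\<epsilon> * jump v + avg v * jump h\<^sub>\<epsilon>\<close>, the kinetic terms cancel again and
  \<open>jump w \<bullet> jump u\<^sub>\<epsilon> = g * jump H * jump h\<^sub>\<epsilon> + avg h\<^sub>\<epsilon> * (jump v)\<^sup>2\<close>. The first summand is nonnegative
  by monotonicity of the reconstruction and the second by nonnegativity of \<open>h\<^sub>\<epsilon>\<close>.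
\<close>

lemma vel_rec_cell [simp]: "vel (rec_cell L R c) = vel c"
  by (simp add: rec_cell_def)

lemma level_rec_cell [simp]:
  "depth (rec_cell L R c) + bottom (rec_cell L R c) = level c"
  by (simp add: rec_cell_def rec_level_def rec_bottom_def)

lemma nc_var_rec_cell: "nc_var (rec_cell L R c) = vector [0, level c]"
  by (simp add: nc_var_def)

lemma depth_rec_cell:
  "depth (rec_cell L R c) = max 0 (level c - max (bottom L) (bottom R))"
  by (auto simp: rec_cell_def rec_level_def rec_bottom_def)

lemma depth_rec_cell_nonneg: "0 \<le> depth (rec_cell L R c)"
  by (simp add: depth_rec_cell)

lemma jump_level_times_jump_depth_rec_cell_nonneg:
  "0 \<le> jump (level L) (level R) * jump (depth (rec_cell L R L)) (depth (rec_cell L R R))"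
  unfolding jump_def depth_rec_cell
  by (cases "level L \<le> level R") (auto intro!: mult_nonneg_nonneg mult_nonpos_nonpos)

lemma jump_entropy_var_inner_flux_EC:
  "jump (entropy_var g L) (entropy_var g R) \<bullet> flux_EC L R =
   avg (entropy_var g L * nc_coeff g (rec_cell L R L))
       (entropy_var g R * nc_coeff g (rec_cell L R R)) \<bullet>
     jump (nc_var (rec_cell L R L)) (nc_var (rec_cell L R R))"
  by (simp add: flux_EC_def Let_def jump_def avg_def entropy_var_def nc_coeff_def nc_var_rec_cell
      inner_vec_def sum_2 level_def power2_eq_square field_simps)

lemma jump_entropy_var_inner_jump_conserved:
  "jump (entropy_var g L) (entropy_var g R) \<bullet>
     jump (conserved (rec_cell L R L)) (conserved (rec_cell L R R)) =
   g * (jump (level L) (level R) * jump (depth (rec_cell L R L)) (depth (rec_cell L R R))) +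
   avg (depth (rec_cell L R L)) (depth (rec_cell L R R)) * (jump (vel L) (vel R))\<^sup>2"
  by (simp add: jump_def avg_def entropy_var_def conserved_def
      inner_vec_def sum_2 level_def power2_eq_square field_simps)

lemma jump_entropy_var_inner_jump_conserved_nonneg:
  assumes "0 \<le> g"
  shows "0 \<le> jump (entropy_var g L) (entropy_var g R) \<bullet>
     jump (conserved (rec_cell L R L)) (conserved (rec_cell L R R))"
  unfolding jump_entropy_var_inner_jump_conserved
  using assms jump_level_times_jump_depth_rec_cell_nonneg
  by (auto simp: avg_def depth_rec_cell_nonneg intro!: add_nonneg_nonneg mult_nonneg_nonneg)

lemma flux_ES_entropy_dissipation:
  assumes "0 \<le> g"
  shows "jump (entropy_var g L) (entropy_var g R) \<bullet> flux_ES g L R -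
           avg (entropy_var g L * nc_coeff g (rec_cell L R L))
               (entropy_var g R * nc_coeff g (rec_cell L R R)) \<bullet>
             jump (nc_var (rec_cell L R L)) (nc_var (rec_cell L R R)) \<le> 0"
  using jump_entropy_var_inner_jump_conserved_nonneg [OF assms, of L R]
  by (simp add: flux_ES_def inner_diff_right jump_entropy_var_inner_flux_EC)

theorem lemma7:
  fixes g :: real
  assumes "0 < g"
  shows "entropy_stable g (flux_ES g) \<and>
         (\<forall>L R. admissible L \<longrightarrow> admissible R \<longrightarrow>
           jump (entropy_var g L) (entropy_var g R) \<bullet> flux_ES g L R -
           avg (entropy_var g L * nc_coeff g (rec_cell L R L))
               (entropy_var g R * nc_coeff g (rec_cell L R R)) \<bullet>
             jump (nc_var (rec_cell L R L)) (nc_var (rec_cell L R R)) \<le> 0)"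
proof -
  have "0 \<le> g"
    using assms by simp
  note diss = flux_ES_entropy_dissipation [OF this]
  have "interface_entropy_rate g (flux_ES g) L R \<le> - jump (entropy_flux g L) (entropy_flux g R)"
    for L R
    using diss [of L R] unfolding interface_entropy_rate_eq by linarith
  with diss show ?thesis
    unfolding entropy_stable_def by blast
qed

end
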